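(* Let $(A,C)_\psi$ be an entwining structure over a field $k$, let $C^n_\psi(A)=\mathrm{Hom}(C\otimes A^n,A)$ for $n\ge0$, let $\pi=\epsilon\otimes\mu\in C^2_\psi(A)$ (i.e. $\pi(c,a,a')=\epsilon(c)aa'$), and for $f\in C^m_\psi(A)$, $g\in C^n_\psi(A)$ let $f\diamond_ig\in C^{m+n-1}_\psi(A)$ be given by $$(f\diamond_ig)(c,a^1,\ldots,a^{m+n-1})=f(c_{(1)},a^1_{\alpha_1},\ldots,a^i_{\alpha_i},g(c_{(2)}{}^{\alpha_1\ldots\alpha_i},a^{i+1},\ldots,a^{i+n}),a^{n+i+1},\ldots,a^{m+n-1})$$ if $0\le i<m$, and $f\diamond_ig=0$ otherwise. Then $(C^\bullet_\psi(A),\diamond,\pi)$ is a weak comp algebra.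
   Context: $k$ is a field, $\otimes=\otimes_k$; algebras are associative and unital, coalgebras are coassociative and counital; $\mathrm{Hom}$ means $k$-linear maps; $V^n=V^{\otimes n}$ (with $V^0=k$); $\mu$ is the product of $A$; $\Delta(c)=c_{(1)}\otimes c_{(2)}$ and $\epsilon$ are the coproduct and counit of $C$. An entwining structure $(A,C)_\psi$ consists of an algebra $A$, a coalgebra $C$ and a $k$-linear map $\psi:C\otimes A\to A\otimes C$, written $\psi(c\otimes a)=a_\alpha\otimes c^\alpha$ (summation understood; repeated application uses further Greek indices), such that for all $a,a'\in A$, $c\in C$: $(aa')_\alpha\otimes c^\alpha=a_\alpha a'_\beta\otimes c^{\alpha\beta}$; $1_\alpha\otimes c^\alpha=1\otimes c$; $a_\alpha\otimes (c^\alpha)_{(1)}\otimes (c^\alpha)_{(2)}=a_{\beta\alpha}\otimes c_{(1)}{}^\alpha\otimes c_{(2)}{}^\beta$; $a_\alpha\epsilon(c^\alpha)=a\epsilon(c)$. A (right) weak comp algebra $(V^\bullet,\diamond,\pi)$ over $k$ consists of a sequence of vector spaces $V^0,V^1,V^2,\ldots$, an element $\pi\in V^2$ and $k$-linear operations $\diamond_i:V^m\otimes V^n\to V^{m+n-1}$ for $i\ge0$ (with $V^{-1}=0$ understood) such that for any $f\in V^m$, $g\in V^n$, $h\in V^p$: (1) $f\diamond_ig=0$ if $i>m-1$; (2) $(f\diamond_ig)\diamond_jh=f\diamond_i(g\diamond_{j-i}h)$ if $i\le j<n+i$; (3) if either $g=\pi$ or $h=\pi$, then $(f\diamond_ig)\diamond_jh=(f\diamond_jh)\diamond_{i+p-1}g$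 if $j<i$; (4) $\pi\diamond_0\pi=\pi\diamond_1\pi$. *)

theory Defs
  imports Complex_Main "HOL-Library.Function_Algebras"
begin

section \<open>Multilinear maps and tensor products over a field\<close>

text \<open>
  A vector space over the field \<open>'k\<close> is a type with a scalar multiplication (locale
  \<^locale>\<open>vector_space\<close>). Linear maps out of a tensor product are written as multilinear maps.
\<close>

definition bilinear_map ::
  "('k::field \<Rightarrow> 'x::ab_group_add \<Rightarrow> 'x) \<Rightarrow> ('k \<Rightarrow> 'y::ab_group_add \<Rightarrow> 'y) \<Rightarrow>
   ('k \<Rightarrow> 'w::ab_group_add \<Rightarrow> 'w) \<Rightarrow> ('x \<Rightarrow> 'y \<Rightarrow> 'w) \<Rightarrow> bool" where
  "bilinear_map s1 s2 s F \<longleftrightarrow>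
     (\<forall>y. Vector_Spaces.linear s1 s (\<lambda>x. F x y)) \<and>
     (\<forall>x. Vector_Spaces.linear s2 s (\<lambda>y. F x y))"

definition trilinear_map ::
  "('k::field \<Rightarrow> 'x::ab_group_add \<Rightarrow> 'x) \<Rightarrow> ('k \<Rightarrow> 'y::ab_group_add \<Rightarrow> 'y) \<Rightarrow>
   ('k \<Rightarrow> 'z::ab_group_add \<Rightarrow> 'z) \<Rightarrow> ('k \<Rightarrow> 'w::ab_group_add \<Rightarrow> 'w) \<Rightarrow>
   ('x \<Rightarrow> 'y \<Rightarrow> 'z \<Rightarrow> 'w) \<Rightarrow> bool" where
  "trilinear_map s1 s2 s3 s F \<longleftrightarrow>
     (\<forall>y z. Vector_Spaces.linear s1 s (\<lambda>x. F x y z)) \<and>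
     (\<forall>x z. Vector_Spaces.linear s2 s (\<lambda>y. F x y z)) \<and>
     (\<forall>x y. Vector_Spaces.linear s3 s (\<lambda>z. F x y z))"

text \<open>
  The tensor product of \<open>X\<close> and \<open>Y\<close> is constructed as the space of those functionals on the
  bilinear forms on \<open>X \<times> Y\<close> that are finite sums of evaluations \<open>x \<otimes> y\<close>. The guard merely
  makes \<open>x \<otimes> y\<close> forget the values at functions that are not bilinear.
  Coefficients are not needed in the sums, since they can be absorbed into one of the factors.
\<close>

type_synonym ('k, 'x, 'y) tensor = "('x \<Rightarrow> 'y \<Rightarrow> 'k) \<Rightarrow> 'k"

type_synonym ('k, 'x, 'y, 'z) tensor3 = "('x \<Rightarrow> 'y \<Rightarrow> 'z \<Rightarrow> 'k) \<Rightarrow> 'k"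

definition pure_tensor ::
  "('k::field \<Rightarrow> 'x::ab_group_add \<Rightarrow> 'x) \<Rightarrow> ('k \<Rightarrow> 'y::ab_group_add \<Rightarrow> 'y) \<Rightarrow>
   'x \<Rightarrow> 'y \<Rightarrow> ('k, 'x, 'y) tensor" where
  "pure_tensor s1 s2 x y = (\<lambda>\<beta>. if bilinear_map s1 s2 (*) \<beta> then \<beta> x y else 0)"

definition pure_tensor3 ::
  "('k::field \<Rightarrow> 'x::ab_group_add \<Rightarrow> 'x) \<Rightarrow> ('k \<Rightarrow> 'y::ab_group_add \<Rightarrow> 'y) \<Rightarrow>
   ('k \<Rightarrow> 'z::ab_group_add \<Rightarrow> 'z) \<Rightarrow> 'x \<Rightarrow> 'y \<Rightarrow> 'z \<Rightarrow> ('k, 'x, 'y, 'z) tensor3" where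
  "pure_tensor3 s1 s2 s3 x y z =
     (\<lambda>\<beta>. if trilinear_map s1 s2 s3 (*) \<beta> then \<beta> x y z else 0)"

definition tensor_scale :: "'k::field \<Rightarrow> ('k, 'x, 'y) tensor \<Rightarrow> ('k, 'x, 'y) tensor" where
  "tensor_scale r t = (\<lambda>\<beta>. r * t \<beta>)"

definition tensor_space ::
  "('k::field \<Rightarrow> 'x::ab_group_add \<Rightarrow> 'x) \<Rightarrow> ('k \<Rightarrow> 'y::ab_group_add \<Rightarrow> 'y) \<Rightarrow>
   ('k, 'x, 'y) tensor set" where
  "tensor_space s1 s2 = {t. \<exists>ps. t = (\<Sum>(x, y)\<leftarrow>ps. pure_tensor s1 s2 x y)}"

text \<open>
  Sweedler summation: for \<open>t = \<Sum> x\<^sub>i \<otimes> y\<^sub>i\<close> this is \<open>\<Sum> F x\<^sub>i y\<^sub>i\<close>, i.e. the value at \<open>t\<close>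
  of the linear map on the tensor product induced by \<open>F\<close>. It is computed from a chosen
  decomposition of \<open>t\<close>; lemma \<open>tensor_sum_eq\<close> below shows that for bilinear \<open>F\<close> the choice
  is irrelevant.
\<close>

definition tensor_sum ::
  "('k::field \<Rightarrow> 'x::ab_group_add \<Rightarrow> 'x) \<Rightarrow> ('k \<Rightarrow> 'y::ab_group_add \<Rightarrow> 'y) \<Rightarrow>
   ('k, 'x, 'y) tensor \<Rightarrow> ('x \<Rightarrow> 'y \<Rightarrow> 'w::monoid_add) \<Rightarrow> 'w" where
  "tensor_sum s1 s2 t F =
     (\<Sum>(x, y)\<leftarrow>(SOME ps. t = (\<Sum>(x, y)\<leftarrow>ps. pure_tensor s1 s2 x y)). F x y)"

lemma sum_list_fun_apply: "sum_list (map f ps) \<beta> = (\<Sum>p\<leftarrow>ps. f p \<beta>)"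
  for f :: "'p \<Rightarrow> 'b \<Rightarrow> 'k::monoid_add"
  by (induction ps) (auto simp: zero_fun_def plus_fun_def)

lemma vector_space_mult: "vector_space ((*) :: 'k::field \<Rightarrow> 'k \<Rightarrow> 'k)"
  by unfold_locales (auto simp: algebra_simps)

lemma linear_functional_separates:
  fixes s :: "'k::field \<Rightarrow> 'w::ab_group_add \<Rightarrow> 'w"
  assumes "vector_space s" and "w \<noteq> 0"
  shows "\<exists>\<phi>. Vector_Spaces.linear s (*) \<phi> \<and> \<phi> w \<noteq> 0"
proof -
  interpret vector_space_pair s "(*)"
    using assms(1) vector_space_mult by (simp add: vector_space_pair_def)
  have "vs1.independent {w}" using assms(2) by simp
  from linear_independent_extend[OF this, of "\<lambda>_. 1"] show ?thesis by auto
qed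

lemma linear_sum_list:
  assumes "Vector_Spaces.linear s1 s2 \<phi>"
  shows "\<phi> (\<Sum>p\<leftarrow>ps. f p) = (\<Sum>p\<leftarrow>ps. \<phi> (f p))"
proof -
  interpret Vector_Spaces.linear s1 s2 \<phi> by (rule assms)
  show ?thesis by (induction ps) (auto simp: add zero)
qed

lemma tensor_sum_eq:
  fixes s :: "'k::field \<Rightarrow> 'w::ab_group_add \<Rightarrow> 'w"
  assumes F: "bilinear_map s1 s2 s F"
    and t: "t = (\<Sum>(x, y)\<leftarrow>ps. pure_tensor s1 s2 x y)"
  shows "tensor_sum s1 s2 t F = (\<Sum>(x, y)\<leftarrow>ps. F x y)"
proof (rule ccontr)
  define qs where "qs = (SOME qs. t = (\<Sum>(x, y)\<leftarrow>qs. pure_tensor s1 s2 x y))"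
  have qs: "t = (\<Sum>(x, y)\<leftarrow>qs. pure_tensor s1 s2 x y)"
    unfolding qs_def by (rule someI[of _ ps]) (rule t)
  let ?d = "(\<Sum>(x, y)\<leftarrow>qs. F x y) - (\<Sum>(x, y)\<leftarrow>ps. F x y)"
  assume "tensor_sum s1 s2 t F \<noteq> (\<Sum>(x, y)\<leftarrow>ps. F x y)"
  then have d: "?d \<noteq> 0" by (simp add: tensor_sum_def qs_def)
  have vs: "vector_space s"
    using F by (auto simp: bilinear_map_def Vector_Spaces.linear_def)
  obtain \<phi> where \<phi>: "Vector_Spaces.linear s (*) \<phi>" "\<phi> ?d \<noteq> 0"
    using linear_functional_separates[OF vs d] by blast
  have b: "bilinear_map s1 s2 (*) (\<lambda>x y. \<phi> (F x y))"
    using F \<phi>(1) Vector_Spaces.linear_compose[of s1 s _ "(*)" \<phi>]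
      Vector_Spaces.linear_compose[of s2 s _ "(*)" \<phi>]
    by (auto simp: bilinear_map_def o_def)
  have ev: "(\<Sum>(x, y)\<leftarrow>rs. pure_tensor s1 s2 x y) (\<lambda>x y. \<phi> (F x y)) = \<phi> (\<Sum>(x, y)\<leftarrow>rs. F x y)"
    for rs
    using b by (simp add: sum_list_fun_apply linear_sum_list[OF \<phi>(1)] pure_tensor_def
        case_prod_beta)
  have "\<phi> (\<Sum>(x, y)\<leftarrow>qs. F x y) = \<phi> (\<Sum>(x, y)\<leftarrow>ps. F x y)"
    using ev[of qs] ev[of ps] qs t by simp
  with \<phi> show False
    by (simp add: module_hom.diff[OF Vector_Spaces.linear.axioms(3)])
qed


section \<open>Algebras, coalgebras and entwining structures\<close>

text \<open>
  The sort \<open>{ring, monoid_mult}\<close> is that of associative unital rings; unlike \<^class>\<open>ring_1\<close> it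
  does not exclude the zero ring.
\<close>

locale k_algebra = vector_space sA
  for sA :: "'k::field \<Rightarrow> 'a::{ring,monoid_mult} \<Rightarrow> 'a" +
  assumes scale_mult_left: "sA r a * b = sA r (a * b)"
    and scale_mult_right: "a * sA r b = sA r (a * b)"

locale k_coalgebra = vector_space sC
  for sC :: "'k::field \<Rightarrow> 'c::ab_group_add \<Rightarrow> 'c" +
  fixes \<Delta> :: "'c \<Rightarrow> ('k, 'c, 'c) tensor"
    and \<epsilon> :: "'c \<Rightarrow> 'k"
  assumes coproduct_in: "\<Delta> c \<in> tensor_space sC sC"
    and coproduct_linear: "Vector_Spaces.linear sC tensor_scale \<Delta>"
    and counit_linear: "Vector_Spaces.linear sC (*) \<epsilon>"
    and coassoc:
      "tensor_sum sC sC (\<Delta> c) (\<lambda>c1 c2.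
         tensor_sum sC sC (\<Delta> c1) (\<lambda>c11 c12. pure_tensor3 sC sC sC c11 c12 c2)) =
       tensor_sum sC sC (\<Delta> c) (\<lambda>c1 c2.
         tensor_sum sC sC (\<Delta> c2) (\<lambda>c21 c22. pure_tensor3 sC sC sC c1 c21 c22))"
    and counit_left: "tensor_sum sC sC (\<Delta> c) (\<lambda>c1 c2. sC (\<epsilon> c1) c2) = c"
    and counit_right: "tensor_sum sC sC (\<Delta> c) (\<lambda>c1 c2. sC (\<epsilon> c2) c1) = c"

text \<open>
  \<open>\<psi> c a\<close> is the image of \<open>c \<otimes> a\<close>. In the third axiom \<open>a\<^sub>\<beta> \<otimes> c\<^sub>(\<^sub>2\<^sub>)\<^sup>\<beta>\<close> is formed first.
\<close>

locale entwining_structure = alg: k_algebra sA + coalg: k_coalgebra sC \<Delta> \<epsilon>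
  for sA :: "'k::field \<Rightarrow> 'a::{ring,monoid_mult} \<Rightarrow> 'a"
    and sC :: "'k \<Rightarrow> 'c::ab_group_add \<Rightarrow> 'c"
    and \<Delta> :: "'c \<Rightarrow> ('k, 'c, 'c) tensor"
    and \<epsilon> :: "'c \<Rightarrow> 'k" +
  fixes \<psi> :: "'c \<Rightarrow> 'a \<Rightarrow> ('k, 'a, 'c) tensor"
  assumes entwining_in: "\<psi> c a \<in> tensor_space sA sC"
    and entwining_bilinear: "bilinear_map sC sA tensor_scale \<psi>"
    and entwining_mult:
      "\<psi> c (a * a') =
       tensor_sum sA sC (\<psi> c a) (\<lambda>x d.
         tensor_sum sA sC (\<psi> d a') (\<lambda>y e. pure_tensor sA sC (x * y) e))"
    and entwining_one: "\<psi> c 1 = pure_tensor sA sC 1 c"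
    and entwining_coproduct:
      "tensor_sum sA sC (\<psi> c a) (\<lambda>x d.
         tensor_sum sC sC (\<Delta> d) (\<lambda>d1 d2. pure_tensor3 sA sC sC x d1 d2)) =
       tensor_sum sC sC (\<Delta> c) (\<lambda>c1 c2.
         tensor_sum sA sC (\<psi> c2 a) (\<lambda>y e.
           tensor_sum sA sC (\<psi> c1 y) (\<lambda>x d. pure_tensor3 sA sC sC x d e)))"
    and entwining_counit: "tensor_sum sA sC (\<psi> c a) (\<lambda>x d. sA (\<epsilon> d) x) = sA (\<epsilon> c) a"


section \<open>Weak comp algebras\<close>

text \<open>
  The spaces \<open>V n\<close> are subspaces of one ambient vector space; any sequence of vector spaces is
  of this form (take the direct sum). Elements do not determine their degree (0 lies in
  every \<open>V n\<close>), so \<open>comp m n i\<close> carries the degrees of its arguments: it is the operation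
  \<open>\<diamond>\<^sub>i : V\<^sup>m \<otimes> V\<^sup>n \<rightarrow> V\<^sup>m\<^sup>+\<^sup>n\<^sup>-\<^sup>1\<close>.

  The convention that the space of degree \<open>-1\<close> is zero only concerns \<open>m = n = 0\<close>. There
  truncated subtraction gives degree 0 instead, which is harmless: all values of \<open>comp 0 0 i\<close>
  are 0 by \<open>comp_eq_0\<close>.
\<close>

locale weak_comp_algebra = vector_space scale
  for scale :: "'k::field \<Rightarrow> 'v::ab_group_add \<Rightarrow> 'v" +
  fixes V :: "nat \<Rightarrow> 'v set"
    and comp :: "nat \<Rightarrow> nat \<Rightarrow> nat \<Rightarrow> 'v \<Rightarrow> 'v \<Rightarrow> 'v"
    and \<pi> :: 'v
  assumes subspace_V: "subspace (V n)"
    and pi_in: "\<pi> \<in> V 2"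
    and comp_in: "\<lbrakk>f \<in> V m; g \<in> V n\<rbrakk> \<Longrightarrow> comp m n i f g \<in> V (m + n - 1)"
    and comp_add_left: "\<lbrakk>f \<in> V m; f' \<in> V m; g \<in> V n\<rbrakk> \<Longrightarrow>
      comp m n i (f + f') g = comp m n i f g + comp m n i f' g"
    and comp_scale_left: "\<lbrakk>f \<in> V m; g \<in> V n\<rbrakk> \<Longrightarrow>
      comp m n i (scale r f) g = scale r (comp m n i f g)"
    and comp_add_right: "\<lbrakk>f \<in> V m; g \<in> V n; g' \<in> V n\<rbrakk> \<Longrightarrow>
      comp m n i f (g + g') = comp m n i f g + comp m n i f g'"
    and comp_scale_right: "\<lbrakk>f \<in> V m; g \<in> V n\<rbrakk> \<Longrightarrow>
      comp m n i f (scale r g) = scale r (comp m n i f g)"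
    and comp_eq_0: "\<lbrakk>f \<in> V m; g \<in> V n; m \<le> i\<rbrakk> \<Longrightarrow> comp m n i f g = 0"
    and comp_assoc: "\<lbrakk>f \<in> V m; g \<in> V n; h \<in> V p; i \<le> j; j < n + i\<rbrakk> \<Longrightarrow>
      comp (m + n - 1) p j (comp m n i f g) h = comp m (n + p - 1) i f (comp n p (j - i) g h)"
    and comp_interchange: "\<lbrakk>f \<in> V m; g \<in> V n; h \<in> V p; j < i;
        (n = 2 \<and> g = \<pi>) \<or> (p = 2 \<and> h = \<pi>)\<rbrakk> \<Longrightarrow>
      comp (m + n - 1) p j (comp m n i f g) h =
      comp (m + p - 1) n (i + p - 1) (comp m p j f h) g"
    and comp_pi_pi: "comp 2 2 0 \<pi> \<pi> = comp 2 2 1 \<pi> \<pi>"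


section \<open>The cochains of an entwining structure\<close>

text \<open>
  A linear map \<open>C \<otimes> A\<^sup>n \<rightarrow> A\<close> is a map \<open>f c as\<close>, multilinear in \<open>c\<close> and the \<open>n\<close> entries of
  the list \<open>as\<close>, and 0 on lists of other lengths.
\<close>

definition cochains ::
  "('k::field \<Rightarrow> 'a::ab_group_add \<Rightarrow> 'a) \<Rightarrow> ('k \<Rightarrow> 'c::ab_group_add \<Rightarrow> 'c) \<Rightarrow>
   nat \<Rightarrow> ('c \<Rightarrow> 'a list \<Rightarrow> 'a) set" where
  "cochains sA sC n = {f.
     (\<forall>c as. length as \<noteq> n \<longrightarrow> f c as = 0) \<and>
     (\<forall>as. length as = n \<longrightarrow> Vector_Spaces.linear sC sA (\<lambda>c. f c as)) \<and>
     (\<forall>c as. \<forall>i<n. length as = n \<longrightarrow> Vector_Spaces.linear sA sA (\<lambda>a. f c (as[i := a])))}"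

definition cochain_scale ::
  "('k \<Rightarrow> 'a \<Rightarrow> 'a) \<Rightarrow> 'k \<Rightarrow> ('c \<Rightarrow> 'a list \<Rightarrow> 'a) \<Rightarrow> 'c \<Rightarrow> 'a list \<Rightarrow> 'a" where
  "cochain_scale sA r f = (\<lambda>c as. sA r (f c as))"

text \<open>
  \<open>entwine_sum sA sC \<psi> c [a\<^sup>1, \<dots>, a\<^sup>i] F\<close> is the summation
  \<open>F [a\<^sup>1\<^sub>\<alpha>\<^sub>1, \<dots>, a\<^sup>i\<^sub>\<alpha>\<^sub>i] c\<^sup>\<alpha>\<^sup>1\<^sup>\<dots>\<^sup>\<alpha>\<^sup>i\<close>.
\<close>

fun entwine_sum ::
  "('k::field \<Rightarrow> 'a::ab_group_add \<Rightarrow> 'a) \<Rightarrow> ('k \<Rightarrow> 'c::ab_group_add \<Rightarrow> 'c) \<Rightarrow>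
   ('c \<Rightarrow> 'a \<Rightarrow> ('k, 'a, 'c) tensor) \<Rightarrow> 'c \<Rightarrow> 'a list \<Rightarrow>
   ('a list \<Rightarrow> 'c \<Rightarrow> 'w::monoid_add) \<Rightarrow> 'w" where
  "entwine_sum sA sC \<psi> c [] F = F [] c"
| "entwine_sum sA sC \<psi> c (a # as) F =
     tensor_sum sA sC (\<psi> c a) (\<lambda>b d. entwine_sum sA sC \<psi> d as (\<lambda>bs. F (b # bs)))"

definition cochain_comp ::
  "('k::field \<Rightarrow> 'a::ab_group_add \<Rightarrow> 'a) \<Rightarrow> ('k \<Rightarrow> 'c::ab_group_add \<Rightarrow> 'c) \<Rightarrow>
   ('c \<Rightarrow> ('k, 'c, 'c) tensor) \<Rightarrow> ('c \<Rightarrow> 'a \<Rightarrow> ('k, 'a, 'c) tensor) \<Rightarrow>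
   nat \<Rightarrow> nat \<Rightarrow> nat \<Rightarrow> ('c \<Rightarrow> 'a list \<Rightarrow> 'a) \<Rightarrow> ('c \<Rightarrow> 'a list \<Rightarrow> 'a) \<Rightarrow>
   'c \<Rightarrow> 'a list \<Rightarrow> 'a" where
  "cochain_comp sA sC \<Delta> \<psi> m n i f g = (\<lambda>c as.
     if i < m \<and> length as = m + n - 1 then
       tensor_sum sC sC (\<Delta> c) (\<lambda>c1 c2.
         entwine_sum sA sC \<psi> c2 (take i as) (\<lambda>bs d.
           f c1 (bs @ [g d (take n (drop i as))] @ drop (n + i) as)))
     else 0)"

definition cochain_pi ::
  "('k \<Rightarrow> 'a::{ring,monoid_mult} \<Rightarrow> 'a) \<Rightarrow> ('c \<Rightarrow> 'k) \<Rightarrow> 'c \<Rightarrow> 'a list \<Rightarrow> 'a" where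
  "cochain_pi sA \<epsilon> = (\<lambda>c as. if length as = 2 then sA (\<epsilon> c) (as ! 0 * as ! 1) else 0)"

end

theory Submission
  imports Defs
begin

text \<open>
  The axioms of an entwining structure are equations between tensors. Linear functionals separate
  the vectors of a vector space, so these equations may be evaluated at arbitrary multilinear maps.
  Induction on the number of arguments extends the axioms on \<open>\<Delta>\<close> and \<open>\<epsilon>\<close> to iterated entwining
  of a list past \<open>c\<close>. Axiom (2) then reduces to coassociativity: on the left the list
  is entwined with \<open>c\<^sub>(\<^sub>2\<^sub>)\<close> and then with \<open>c\<^sub>(\<^sub>1\<^sub>)\<^sub>(\<^sub>2\<^sub>)\<close>, and on the right with \<open>c\<^sub>(\<^sub>2\<^sub>)\<close>, whose
  result is split afterwards; the coproduct axiom identifies the two. By the counit axioms, inserting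
  \<open>\<pi>\<close> at position \<open>i\<close> just multiplies two neighbouring arguments, \<open>f(c, \<dots>, a, b, \<dots>) \<mapsto> f(c, \<dots>, ab, \<dots>)\<close>,
  which yields (4), and (3) together with multiplicativity of the entwining.
\<close>

section \<open>Sweedler summation\<close>

text \<open>Functionals separate vectors. Tensors here are functionals on scalar-valued forms, so
  testing with \<open>\<phi>\<close> turns identities with values in any vector space into
  evaluations of tensors.\<close>

lemma vector_eqI:
  fixes s :: "'k::field \<Rightarrow> 'w::ab_group_add \<Rightarrow> 'w"
  assumes "vector_space s"
    and eq: "\<And>\<phi>. Vector_Spaces.linear s (*) \<phi> \<Longrightarrow> \<phi> v = \<phi> w"
  shows "v = w"
proof (rule ccontr)
  assume "v \<noteq> w"
  then obtain \<phi> where \<phi>: "Vector_Spaces.linear s (*) \<phi>" "\<phi> (v - w) \<noteq> 0"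
    using linear_functional_separates[OF assms(1), of "v - w"] by auto
  then show False
    using eq[OF \<phi>(1)] by (simp add: module_hom.diff[OF Vector_Spaces.linear.axioms(3)])
qed

lemma linear_compose_fun:
  assumes "Vector_Spaces.linear s2 s3 g" "Vector_Spaces.linear s1 s2 f"
  shows "Vector_Spaces.linear s1 s3 (\<lambda>x. g (f x))"
  using Vector_Spaces.linear_compose[OF assms(2,1)] by (simp add: o_def)

lemma tensor_sum_cong:
  assumes "\<And>x y. F x y = G x y"
  shows "tensor_sum s1 s2 t F = tensor_sum s1 s2 t G"
  using assms by presburger

text \<open>
  No bilinearity of \<open>F\<close> is needed here: both sides use the same chosen decomposition of \<open>t\<close>.
\<close>

lemma linear_tensor_sum:
  assumes "Vector_Spaces.linear s s' \<phi>"
  shows "\<phi> (tensor_sum s1 s2 t F) = tensor_sum s1 s2 t (\<lambda>x y. \<phi> (F x y))"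
  unfolding tensor_sum_def linear_sum_list[OF assms] by (simp add: case_prod_unfold)

lemma tensor_sum_fun_apply:
  fixes F :: "'x::ab_group_add \<Rightarrow> 'y::ab_group_add \<Rightarrow> 'b \<Rightarrow> 'w::monoid_add"
  shows "tensor_sum s1 s2 t F \<beta> = tensor_sum s1 s2 t (\<lambda>x y. F x y \<beta>)"
  unfolding tensor_sum_def by (simp add: sum_list_fun_apply case_prod_unfold)

lemma tensor_sum_zero: "tensor_sum s1 s2 t (\<lambda>x y. 0) = 0"
  by (simp add: tensor_sum_def case_prod_unfold)

lemma tensor_sum_add:
  fixes F G :: "_ \<Rightarrow> _ \<Rightarrow> 'w::comm_monoid_add"
  shows "tensor_sum s1 s2 t (\<lambda>x y. F x y + G x y) = tensor_sum s1 s2 t F + tensor_sum s1 s2 t G"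
  by (simp add: tensor_sum_def case_prod_unfold sum_list_addf)

lemma tensor_sum_swap:
  fixes F :: "_ \<Rightarrow> _ \<Rightarrow> _ \<Rightarrow> _ \<Rightarrow> 'w::comm_monoid_add"
  shows "tensor_sum s1 s2 t (\<lambda>x y. tensor_sum s3 s4 u (\<lambda>z w. F x y z w)) =
    tensor_sum s3 s4 u (\<lambda>z w. tensor_sum s1 s2 t (\<lambda>x y. F x y z w))"
proof -
  have "(\<Sum>p\<leftarrow>ps. \<Sum>q\<leftarrow>qs. H p q) = (\<Sum>q\<leftarrow>qs. \<Sum>p\<leftarrow>ps. H p q)"
    for H :: "_ \<Rightarrow> _ \<Rightarrow> 'w" and ps qs
    by (induction ps) (simp_all add: sum_list_addf)
  then show ?thesis
    by (simp add: tensor_sum_def case_prod_unfold)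
qed

text \<open>As \<open>t\<close> is fixed, the same decomposition serves for every \<open>x\<close>,
  and linearity is checked summand by summand.\<close>

lemma linear_tensor_sum_param:
  assumes F: "\<And>y z. Vector_Spaces.linear sX s (\<lambda>x. F x y z)"
  shows "Vector_Spaces.linear sX s (\<lambda>x. tensor_sum s1 s2 t (F x))"
proof -
  have vs: "vector_space sX" "vector_space s"
    and add: "F (x + x') = (\<lambda>y z. F x y z + F x' y z)"
    and scale: "F (sX r x) = (\<lambda>y z. s r (F x y z))" for x x' r
    using F by (auto simp: Vector_Spaces.linear_iff fun_eq_iff)
  interpret vector_space s by (rule vs)
  have "Vector_Spaces.linear s s (s r)" for r
    by (rule linear_scale_self)
  then show ?thesis
    using vs by (simp add: Vector_Spaces.linear_iff add scale tensor_sum_add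
        linear_tensor_sum[where s = s and s' = s and \<phi> = "s _"])
qed

lemma bilinear_map_compose:
  assumes "Vector_Spaces.linear s s' \<phi>" "bilinear_map s1 s2 s F"
  shows "bilinear_map s1 s2 s' (\<lambda>x y. \<phi> (F x y))"
  using assms by (simp add: bilinear_map_def Vector_Spaces.linear_iff)

text \<open>A tensor is a functional on bilinear forms, and \<open>\<phi>\<close> composed with
  \<open>F\<close> is such a form. The right-hand side no longer mentions the chosen
  decomposition.\<close>

lemma tensor_sum_eval:
  assumes F: "bilinear_map s1 s2 s F" and \<phi>: "Vector_Spaces.linear s (*) \<phi>"
    and t: "t \<in> tensor_space s1 s2"
  shows "\<phi> (tensor_sum s1 s2 t F) = t (\<lambda>x y. \<phi> (F x y))"
proof -
  obtain ps where ps: "t = (\<Sum>(x, y)\<leftarrow>ps. pure_tensor s1 s2 x y)"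
    using t by (auto simp: tensor_space_def)
  have b: "bilinear_map s1 s2 (*) (\<lambda>x y. \<phi> (F x y))"
    by (rule bilinear_map_compose[OF \<phi> F])
  show ?thesis
    unfolding tensor_sum_eq[OF F ps] linear_sum_list[OF \<phi>]
    by (simp add: ps sum_list_fun_apply pure_tensor_def case_prod_unfold b)
qed

text \<open>The decompositions chosen for \<open>T (x + y)\<close>, \<open>T x\<close> and
  \<open>T y\<close> are unrelated, so summands cannot be compared. Under a functional each sum
  becomes a value of the tensor itself, which depends linearly on \<open>x\<close>.\<close>

lemma linear_tensor_sum_arg:
  assumes F: "bilinear_map s1 s2 s F"
    and T: "Vector_Spaces.linear sX tensor_scale T" "\<And>x. T x \<in> tensor_space s1 s2"
  shows "Vector_Spaces.linear sX s (\<lambda>x. tensor_sum s1 s2 (T x) F)"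
proof -
  have vs: "vector_space s" "vector_space sX"
    using F T(1) by (auto simp: bilinear_map_def Vector_Spaces.linear_iff)
  have T_add: "T (x + y) \<beta> = T x \<beta> + T y \<beta>" and T_scale: "T (sX r x) \<beta> = r * T x \<beta>" for x y r \<beta>
    using T(1) by (auto simp: Vector_Spaces.linear_iff tensor_scale_def)
  have "tensor_sum s1 s2 (T (x + y)) F = tensor_sum s1 s2 (T x) F + tensor_sum s1 s2 (T y) F" for x y
  proof (rule vector_eqI[OF vs(1)])
    fix \<phi> assume \<phi>: "Vector_Spaces.linear s (*) \<phi>"
    then have "\<phi> (u + v) = \<phi> u + \<phi> v" for u v by (auto simp: Vector_Spaces.linear_iff)
    then show "\<phi> (tensor_sum s1 s2 (T (x + y)) F) =
        \<phi> (tensor_sum s1 s2 (T x) F + tensor_sum s1 s2 (T y) F)"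
      by (simp add: tensor_sum_eval[OF F \<phi> T(2)] T_add)
  qed
  moreover have "tensor_sum s1 s2 (T (sX r x)) F = s r (tensor_sum s1 s2 (T x) F)" for x r
  proof (rule vector_eqI[OF vs(1)])
    fix \<phi> assume \<phi>: "Vector_Spaces.linear s (*) \<phi>"
    then have "\<phi> (s r u) = r * \<phi> u" for u by (auto simp: Vector_Spaces.linear_iff)
    then show "\<phi> (tensor_sum s1 s2 (T (sX r x)) F) = \<phi> (s r (tensor_sum s1 s2 (T x) F))"
      by (simp add: tensor_sum_eval[OF F \<phi> T(2)] T_scale)
  qed
  ultimately show ?thesis
    using vs by (simp add: Vector_Spaces.linear_iff)
qed

lemma trilinear_map_compose:
  assumes "Vector_Spaces.linear s s' \<phi>" "trilinear_map s1 s2 s3 s T"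
  shows "trilinear_map s1 s2 s3 s' (\<lambda>x y z. \<phi> (T x y z))"
  using assms by (simp add: trilinear_map_def Vector_Spaces.linear_iff)

section \<open>Coalgebra identities for arbitrary multilinear maps\<close>

context k_coalgebra
begin

lemma vector_space_C: "vector_space sC"
  by unfold_locales

lemma linear_coproduct_sum:
  "bilinear_map sC sC s F \<Longrightarrow> Vector_Spaces.linear sC s (\<lambda>c. tensor_sum sC sC (\<Delta> c) F)"
  by (rule linear_tensor_sum_arg[OF _ coproduct_linear coproduct_in])

text \<open>Coassociativity equates functionals on trilinear forms. It is evaluated at
  \<open>\<phi>\<close> composed with \<open>T\<close>, for which the guard in
  \<open>pure_tensor3\<close> holds.\<close>

lemma coassoc_sum:
  assumes T: "trilinear_map sC sC sC s T"
  shows "tensor_sum sC sC (\<Delta> c) (\<lambda>c1 c2. tensor_sum sC sC (\<Delta> c1) (\<lambda>c11 c12. T c11 c12 c2)) =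
    tensor_sum sC sC (\<Delta> c) (\<lambda>c1 c2. tensor_sum sC sC (\<Delta> c2) (\<lambda>c21 c22. T c1 c21 c22))"
proof (rule vector_eqI)
  show "vector_space s" using T by (simp add: trilinear_map_def Vector_Spaces.linear_iff)
  fix \<phi> assume \<phi>: "Vector_Spaces.linear s (*) \<phi>"
  from coassoc[of c, THEN fun_cong, of "\<lambda>x y z. \<phi> (T x y z)"]
  show "\<phi> (tensor_sum sC sC (\<Delta> c) (\<lambda>c1 c2. tensor_sum sC sC (\<Delta> c1) (\<lambda>c11 c12. T c11 c12 c2))) =
    \<phi> (tensor_sum sC sC (\<Delta> c) (\<lambda>c1 c2. tensor_sum sC sC (\<Delta> c2) (\<lambda>c21 c22. T c1 c21 c22)))"
    by (simp add: linear_tensor_sum[OF \<phi>] tensor_sum_fun_apply pure_tensor3_def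
        trilinear_map_compose[OF \<phi> T])
qed

lemma counit_right_sum:
  assumes L: "Vector_Spaces.linear sC s L"
  shows "tensor_sum sC sC (\<Delta> c) (\<lambda>c1 c2. s (\<epsilon> c2) (L c1)) = L c"
proof -
  have "s r (L x) = L (sC r x)" for r x
    using L by (simp add: Vector_Spaces.linear_iff)
  then show ?thesis
    by (simp add: linear_tensor_sum[OF L, symmetric] counit_right)
qed

end

section \<open>Entwining identities for arbitrary multilinear maps\<close>

context entwining_structure
begin

lemma vector_space_A: "vector_space sA"
  by unfold_locales

lemma linear_entwining_sum_coalg:
  "bilinear_map sA sC s F \<Longrightarrow> Vector_Spaces.linear sC s (\<lambda>c. tensor_sum sA sC (\<psi> c a) F)"
  using entwining_bilinear
  by (intro linear_tensor_sum_arg entwining_in) (auto simp: bilinear_map_def)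

lemma linear_entwining_sum_alg:
  "bilinear_map sA sC s F \<Longrightarrow> Vector_Spaces.linear sA s (\<lambda>a. tensor_sum sA sC (\<psi> c a) F)"
  using entwining_bilinear
  by (intro linear_tensor_sum_arg entwining_in) (auto simp: bilinear_map_def)

text \<open>Under a functional the left side is the value of the tensor
  \<open>\<psi> c (a * a')\<close> at a bilinear form. The axiom expands this tensor into an
  iterated sum of pure tensors, whose values give the right side.\<close>

lemma entwining_mult_sum:
  assumes F: "bilinear_map sA sC s F"
  shows "tensor_sum sA sC (\<psi> c (a * a')) F =
    tensor_sum sA sC (\<psi> c a) (\<lambda>x d. tensor_sum sA sC (\<psi> d a') (\<lambda>y e. F (x * y) e))"
proof (rule vector_eqI)
  show "vector_space s" using F by (simp add: bilinear_map_def Vector_Spaces.linear_iff)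
  fix \<phi> assume \<phi>: "Vector_Spaces.linear s (*) \<phi>"
  have "bilinear_map sA sC (*) (\<lambda>x y. \<phi> (F x y))"
    by (rule bilinear_map_compose[OF \<phi> F])
  then show "\<phi> (tensor_sum sA sC (\<psi> c (a * a')) F) =
    \<phi> (tensor_sum sA sC (\<psi> c a) (\<lambda>x d. tensor_sum sA sC (\<psi> d a') (\<lambda>y e. F (x * y) e)))"
    by (subst tensor_sum_eval[OF F \<phi> entwining_in])
      (simp add: entwining_mult linear_tensor_sum[OF \<phi>] tensor_sum_fun_apply pure_tensor_def)
qed

lemma entwining_coproduct_sum:
  assumes T: "trilinear_map sA sC sC s T"
  shows "tensor_sum sA sC (\<psi> c a) (\<lambda>x d. tensor_sum sC sC (\<Delta> d) (\<lambda>d1 d2. T x d1 d2)) =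
    tensor_sum sC sC (\<Delta> c) (\<lambda>c1 c2. tensor_sum sA sC (\<psi> c2 a) (\<lambda>y e.
      tensor_sum sA sC (\<psi> c1 y) (\<lambda>x d. T x d e)))"
proof (rule vector_eqI)
  show "vector_space s" using T by (simp add: trilinear_map_def Vector_Spaces.linear_iff)
  fix \<phi> assume \<phi>: "Vector_Spaces.linear s (*) \<phi>"
  from entwining_coproduct[of c a, THEN fun_cong, of "\<lambda>x y z. \<phi> (T x y z)"]
  show "\<phi> (tensor_sum sA sC (\<psi> c a) (\<lambda>x d. tensor_sum sC sC (\<Delta> d) (\<lambda>d1 d2. T x d1 d2))) =
    \<phi> (tensor_sum sC sC (\<Delta> c) (\<lambda>c1 c2. tensor_sum sA sC (\<psi> c2 a) (\<lambda>y e.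
      tensor_sum sA sC (\<psi> c1 y) (\<lambda>x d. T x d e))))"
    by (simp add: linear_tensor_sum[OF \<phi>] tensor_sum_fun_apply pure_tensor3_def
        trilinear_map_compose[OF \<phi> T])
qed

lemma entwining_counit_sum:
  assumes L: "Vector_Spaces.linear sA s L"
  shows "tensor_sum sA sC (\<psi> c a) (\<lambda>x d. s (\<epsilon> d) (L x)) = s (\<epsilon> c) (L a)"
proof -
  have "s r (L x) = L (sA r x)" for r x
    using L by (simp add: Vector_Spaces.linear_iff)
  then show ?thesis
    by (simp add: linear_tensor_sum[OF L, symmetric] entwining_counit)
qed

end

section \<open>Iterated entwining\<close>

text \<open>Slots are marked by splitting the list as \<open>as @ a # as'\<close> instead of by list
  update, which suits induction on lists and splitting into blocks. The list comes before the
  coalgebra element, as in the summands of \<open>entwine_sum\<close>.\<close>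

definition multilinear_map ::
  "('k::field \<Rightarrow> 'a::ab_group_add \<Rightarrow> 'a) \<Rightarrow> ('k \<Rightarrow> 'c::ab_group_add \<Rightarrow> 'c) \<Rightarrow>
   ('k \<Rightarrow> 'w::ab_group_add \<Rightarrow> 'w) \<Rightarrow> nat \<Rightarrow> ('a list \<Rightarrow> 'c \<Rightarrow> 'w) \<Rightarrow> bool" where
  "multilinear_map sA sC s n F \<longleftrightarrow>
     (\<forall>as. length as = n \<longrightarrow> Vector_Spaces.linear sC s (F as)) \<and>
     (\<forall>c as as'. Suc (length as + length as') = n \<longrightarrow>
       Vector_Spaces.linear sA s (\<lambda>a. F (as @ a # as') c))"

lemma multilinear_mapI:
  assumes "\<And>as. length as = n \<Longrightarrow> Vector_Spaces.linear sC s (\<lambda>c. F as c)"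
    and "\<And>c as as'. Suc (length as + length as') = n \<Longrightarrow>
       Vector_Spaces.linear sA s (\<lambda>a. F (as @ a # as') c)"
  shows "multilinear_map sA sC s n F"
  using assms by (auto simp: multilinear_map_def)

lemma multilinear_mapD:
  assumes "multilinear_map sA sC s n F"
  shows "length as = n \<Longrightarrow> Vector_Spaces.linear sC s (\<lambda>c. F as c)"
    and "Suc (length bs + length bs') = n \<Longrightarrow> Vector_Spaces.linear sA s (\<lambda>a. F (bs @ a # bs') c)"
  using assms by (auto simp: multilinear_map_def)

lemma multilinear_map_compose:
  assumes "Vector_Spaces.linear s s' \<phi>" "multilinear_map sA sC s n F"
  shows "multilinear_map sA sC s' n (\<lambda>as c. \<phi> (F as c))"
  using assms by (simp add: multilinear_map_def Vector_Spaces.linear_iff)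

lemma multilinear_map_append:
  assumes "multilinear_map sA sC s (length xs + n) F"
  shows "multilinear_map sA sC s n (\<lambda>as. F (xs @ as))"
  using multilinear_mapD(1)[OF assms, of "xs @ _"] multilinear_mapD(2)[OF assms, of "xs @ _"]
  by (intro multilinear_mapI) simp_all

lemma multilinear_map_Cons:
  assumes "multilinear_map sA sC s (Suc n) F"
  shows "multilinear_map sA sC s n (\<lambda>as. F (b # as))"
    and "length as = n \<Longrightarrow> Vector_Spaces.linear sA s (\<lambda>a. F (a # as) c)"
  subgoal
    using multilinear_map_append[of sA sC s "[b]"] assms by simp
  subgoal
    using multilinear_mapD(2)[OF assms, of "[]"] by simp
  done

lemma cochains_iff:
  fixes sA :: "'k::field \<Rightarrow> 'a::ab_group_add \<Rightarrow> 'a"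
  shows
  "f \<in> cochains sA sC n \<longleftrightarrow>
     (\<forall>c as. length as \<noteq> n \<longrightarrow> f c as = 0) \<and> multilinear_map sA sC sA n (\<lambda>as c. f c as)"
proof -
  have "(\<forall>c as. \<forall>i<n. length as = n \<longrightarrow> Vector_Spaces.linear sA sA (\<lambda>a. f c (as[i := a]))) \<longleftrightarrow>
    (\<forall>c as as'. Suc (length as + length as') = n \<longrightarrow>
       Vector_Spaces.linear sA sA (\<lambda>a. f c (as @ a # as')))" (is "?L \<longleftrightarrow> ?R")
  proof
    assume L: ?L
    show ?R
    proof (intro allI impI)
      fix c and as as' :: "'a list" assume "Suc (length as + length as') = n"
      then show "Vector_Spaces.linear sA sA (\<lambda>a. f c (as @ a # as'))"
        \<comment> \<open>The update overwrites this entry, so any filler works.\<close>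
        using L[rule_format, of "length as" "as @ undefined # as'" c] by simp
    qed
  next
    assume R: ?R
    show ?L
    proof (intro allI impI)
      fix c i and as :: "'a list" assume "i < n" "length as = n"
      then show "Vector_Spaces.linear sA sA (\<lambda>a. f c (as[i := a]))"
        using R[rule_format, of "take i as" "drop (Suc i) as" c]
        by (simp add: upd_conv_take_nth_drop)
    qed
  qed
  then show ?thesis
    by (simp only: cochains_def multilinear_map_def mem_Collect_eq)
qed

section \<open>Calculus of iterated entwining sums\<close>

context entwining_structure
begin

abbreviation ent :: "'c \<Rightarrow> 'a list \<Rightarrow> ('a list \<Rightarrow> 'c \<Rightarrow> 'w::monoid_add) \<Rightarrow> 'w" where
  "ent \<equiv> entwine_sum sA sC \<psi>"

text \<open>Entwining keeps the length of the list. Later proofs depend on this, since cochains are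
  linear only on lists of the right length.\<close>

lemma ent_cong:
  assumes "\<And>bs d. length bs = length as \<Longrightarrow> F bs d = G bs d"
  shows "ent c as F = ent c as G"
  using assms
proof (induction as arbitrary: c F G)
  case (Cons a as)
  have "ent d as (\<lambda>bs. F (b # bs)) = ent d as (\<lambda>bs. G (b # bs))" for b d
    by (rule Cons.IH) (simp add: Cons.prems)
  then show ?case by simp
qed simp

lemma ent_append: "ent c (as @ as') F = ent c as (\<lambda>bs d. ent d as' (\<lambda>bs'. F (bs @ bs')))"
  by (induction as arbitrary: c F) simp_all

lemma linear_ent:
  assumes "Vector_Spaces.linear s s' \<phi>"
  shows "\<phi> (ent c as F) = ent c as (\<lambda>bs d. \<phi> (F bs d))"
  by (induction as arbitrary: c F) (simp_all add: linear_tensor_sum[OF assms])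

lemma ent_tensor_sum_swap:
  fixes F :: "_ \<Rightarrow> _ \<Rightarrow> _ \<Rightarrow> _ \<Rightarrow> 'w::comm_monoid_add"
  shows "ent c as (\<lambda>bs d. tensor_sum s1 s2 t (\<lambda>x y. F bs d x y)) =
    tensor_sum s1 s2 t (\<lambda>x y. ent c as (\<lambda>bs d. F bs d x y))"
  by (induction as arbitrary: c F) (simp_all add: tensor_sum_swap[of _ _ _ s1])

text \<open>The two entwinings start from independent data, so the finite sums can be
  exchanged.\<close>

lemma ent_swap:
  fixes F :: "_ \<Rightarrow> _ \<Rightarrow> _ \<Rightarrow> _ \<Rightarrow> 'w::comm_monoid_add"
  shows "ent c as (\<lambda>bs d. ent c' as' (\<lambda>bs' d'. F bs d bs' d')) =
    ent c' as' (\<lambda>bs' d'. ent c as (\<lambda>bs d. F bs d bs' d'))"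
  by (induction as' arbitrary: c' F) (simp_all add: ent_tensor_sum_swap)

lemma linear_ent_param:
  assumes "\<And>bs d. length bs = length as \<Longrightarrow> Vector_Spaces.linear sX s (\<lambda>x. F x bs d)"
  shows "Vector_Spaces.linear sX s (\<lambda>x. ent c as (\<lambda>bs d. F x bs d))"
  using assms by (induction as arbitrary: c F) (auto intro!: linear_tensor_sum_param)

text \<open>After the head has been entwined, the summand is bilinear in the new head
  \<open>b\<close> and the new element \<open>d\<close>: linearity in \<open>d\<close> is the
  induction hypothesis, linearity in \<open>b\<close> comes from the first slot of \<open>F\<close>.
  The slot to be varied is then either the head or lies in the tail.\<close>

lemma multilinear_ent:
  assumes "multilinear_map sA sC s n F"
  shows "multilinear_map sA sC s n (\<lambda>as c. ent c as F)"
  using assms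
proof (induction n arbitrary: F)
  case 0
  then show ?case by (simp add: multilinear_map_def)
next
  case (Suc n)
  note IH = Suc.IH[OF multilinear_map_Cons(1)[OF Suc.prems]]
  have b: "bilinear_map sA sC s (\<lambda>b d. ent d as (\<lambda>bs. F (b # bs)))" if "length as = n" for as
    using that multilinear_mapD(1)[OF IH] multilinear_map_Cons(2)[OF Suc.prems]
    by (auto simp: bilinear_map_def intro!: linear_ent_param)
  show ?case
  proof (rule multilinear_mapI)
    fix as :: "'a list" assume "length as = Suc n"
    then show "Vector_Spaces.linear sC s (\<lambda>c. ent c as F)"
      by (cases as) (simp_all add: linear_entwining_sum_coalg b)
  next
    fix c and as as' :: "'a list" assume "Suc (length as + length as') = Suc n"
    then show "Vector_Spaces.linear sA s (\<lambda>a. ent c (as @ a # as') F)"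
      by (cases as)
        (auto intro!: linear_entwining_sum_alg b linear_tensor_sum_param multilinear_mapD(2)[OF IH])
  qed
qed

lemma ent_counit:
  assumes "vector_space s"
    and "\<And>bs bs'. Suc (length bs + length bs') = length as \<Longrightarrow>
      Vector_Spaces.linear sA s (\<lambda>a. F (bs @ a # bs'))"
  shows "ent c as (\<lambda>bs d. s (\<epsilon> d) (F bs)) = s (\<epsilon> c) (F as)"
  using assms(2)
proof (induction as arbitrary: c F)
  case (Cons a as)
  have "ent d as (\<lambda>bs e. s (\<epsilon> e) (F (b # bs))) = s (\<epsilon> d) (F (b # as))" for b d
    using Cons.prems[of "b # _"] by (intro Cons.IH) simp
  moreover have "Vector_Spaces.linear sA s (\<lambda>b. F (b # as))"
    using Cons.prems[of "[]"] by simp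
  ultimately show ?case
    by (simp add: entwining_counit_sum[where L = "\<lambda>b. F (b # as)"])
qed simp

text \<open>This is multiplicativity of the entwining at the head of a list. The factors are
  entwined as a list of two entries, \<open>bs ! 0\<close> and \<open>bs ! 1\<close>, and multiplied
  only afterwards.\<close>

lemma ent_mult:
  assumes F: "multilinear_map sA sC s (Suc (length as)) F"
  shows "ent c (a * a' # as) F =
    ent c [a, a'] (\<lambda>bs d. ent d as (\<lambda>bs'. F (bs ! 0 * bs ! 1 # bs')))"
proof -
  have "bilinear_map sA sC s (\<lambda>b d. ent d as (\<lambda>bs. F (b # bs)))"
    using multilinear_mapD(1)[OF multilinear_ent[OF multilinear_map_Cons(1)[OF F]]]
      multilinear_map_Cons(2)[OF F]
    by (auto simp: bilinear_map_def intro!: linear_ent_param)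
  then show ?thesis
    by (simp add: entwining_mult_sum)
qed

text \<open>Linearity in \<open>e\<close> comes from the summands, linearity in the entries of
  \<open>bs\<close> from the entwining itself; hence one hypothesis on \<open>G\<close> for each
  coalgebra argument.\<close>

lemma multilinear_ent_ent:
  assumes "\<And>d. multilinear_map sA sC s n (\<lambda>bs e. G bs d e)"
    and "\<And>e. multilinear_map sA sC s n (\<lambda>bs d. G bs d e)"
  shows "multilinear_map sA sC s n (\<lambda>bs e. ent c bs (\<lambda>bs' d. G bs' d e))"
  using multilinear_mapD(1)[OF assms(1)] multilinear_mapD(2)[OF multilinear_ent[OF assms(2)]]
  by (intro multilinear_mapI linear_ent_param) auto

text \<open>The induction hypothesis carries the coproduct across the tail, and the coproduct axiom
  carries it across the head. As in the axiom, the list meets \<open>c2\<close> first and the result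
  then meets \<open>c1\<close>.\<close>

lemma ent_coproduct:
  assumes "\<And>d. multilinear_map sA sC s (length as) (\<lambda>bs e. G bs d e)"
    and "\<And>e. multilinear_map sA sC s (length as) (\<lambda>bs d. G bs d e)"
  shows "ent c as (\<lambda>bs d. tensor_sum sC sC (\<Delta> d) (\<lambda>d1 d2. G bs d1 d2)) =
    tensor_sum sC sC (\<Delta> c) (\<lambda>c1 c2. ent c2 as (\<lambda>bs e. ent c1 bs (\<lambda>bs' d. G bs' d e)))"
  using assms
proof (induction as arbitrary: c G)
  case (Cons a as)
  note G1 = Cons.prems(1)[simplified] and G2 = Cons.prems(2)[simplified]
  \<comment> \<open>\<open>T x d1 d2\<close> is what the tail contributes once the head has become
    \<open>x\<close> and the coalgebra element has been split into \<open>d1\<close> and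
    \<open>d2\<close>.\<close>
  define T where "T x d1 d2 = ent d2 as (\<lambda>bs e. ent d1 bs (\<lambda>bs' d. G (x # bs') d e))" for x d1 d2
  have mult: "multilinear_map sA sC s (length as) (\<lambda>bs e. ent d1 bs (\<lambda>bs' d. G (x # bs') d e))"
    for x d1
    by (intro multilinear_ent_ent multilinear_map_Cons(1)[OF G1] multilinear_map_Cons(1)[OF G2])
  have T: "trilinear_map sA sC sC s T"
    unfolding trilinear_map_def T_def
    using multilinear_mapD(1)[OF multilinear_ent[OF mult]]
      multilinear_mapD(1)[OF multilinear_ent[OF multilinear_map_Cons(1)[OF G2]]]
      multilinear_map_Cons(2)[OF G2]
    by (auto intro!: linear_ent_param)
  have "ent c (a # as) (\<lambda>bs d. tensor_sum sC sC (\<Delta> d) (\<lambda>d1 d2. G bs d1 d2)) =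
      tensor_sum sA sC (\<psi> c a) (\<lambda>b d. tensor_sum sC sC (\<Delta> d) (\<lambda>d1 d2. T b d1 d2))"
    unfolding T_def using multilinear_map_Cons(1)[OF G1] multilinear_map_Cons(1)[OF G2]
    by (simp add: Cons.IH)
  also have "\<dots> = tensor_sum sC sC (\<Delta> c) (\<lambda>c1 c2. tensor_sum sA sC (\<psi> c2 a) (\<lambda>y e.
      tensor_sum sA sC (\<psi> c1 y) (\<lambda>x d. T x d e)))"
    by (rule entwining_coproduct_sum[OF T])
  also have "\<dots> = tensor_sum sC sC (\<Delta> c) (\<lambda>c1 c2.
      ent c2 (a # as) (\<lambda>bs e. ent c1 bs (\<lambda>bs' d. G bs' d e)))"
    \<comment> \<open>Entwining the tail past \<open>e\<close> and entwining \<open>y\<close> past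
      \<open>c1\<close> are independent. Exchanging them assembles the two passes over the whole
      list.\<close>
    by (simp add: T_def ent_tensor_sum_swap)
  finally show ?case .
qed simp

lemma ent_zero: "ent c as (\<lambda>bs d. 0) = 0"
  by (induction as arbitrary: c) (simp_all add: tensor_sum_zero)

lemma ent_add:
  fixes F G :: "_ \<Rightarrow> _ \<Rightarrow> 'w::comm_monoid_add"
  shows "ent c as (\<lambda>bs d. F bs d + G bs d) = ent c as F + ent c as G"
  by (induction as arbitrary: c F G) (simp_all add: tensor_sum_add)

end

section \<open>The weak comp algebra of cochains\<close>

lemma length_eq_addE:
  assumes "length as = p + q"
  obtains xs ys where "as = xs @ ys" "length xs = p" "length ys = q"
  using that[of "take p as" "drop p as"] assms by simp

lemma cochainsI:
  assumes "\<And>c as. length as \<noteq> n \<Longrightarrow> f c as = 0"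
    and "\<And>as. length as = n \<Longrightarrow> Vector_Spaces.linear sC sA (\<lambda>c. f c as)"
    and "\<And>c as as'. Suc (length as + length as') = n \<Longrightarrow>
       Vector_Spaces.linear sA sA (\<lambda>a. f c (as @ a # as'))"
  shows "f \<in> cochains sA sC n"
  using assms by (auto simp: cochains_iff multilinear_map_def)

lemma cochainsD:
  assumes "f \<in> cochains sA sC n"
  shows "length as \<noteq> n \<Longrightarrow> f c as = 0"
    and "length as = n \<Longrightarrow> Vector_Spaces.linear sC sA (\<lambda>c. f c as)"
    and "Suc (length bs + length bs') = n \<Longrightarrow>
       Vector_Spaces.linear sA sA (\<lambda>a. f c (bs @ a # bs'))"
  using assms by (auto simp: cochains_iff multilinear_map_def)

section \<open>Composition of cochains\<close>

context entwining_structure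
begin

abbreviation cop :: "'c \<Rightarrow> ('c \<Rightarrow> 'c \<Rightarrow> 'w::monoid_add) \<Rightarrow> 'w" where
  "cop c \<equiv> tensor_sum sC sC (\<Delta> c)"

abbreviation comp where
  "comp \<equiv> cochain_comp sA sC \<Delta> \<psi>"

text \<open>Three blocks replace \<open>take\<close> and \<open>drop\<close>: \<open>X\<close> is
  entwined, \<open>G\<close> goes to \<open>g\<close>, and \<open>W\<close> stays behind. The
  lengths imply both guards of the definition.\<close>

lemma comp_split:
  assumes "length X = i" "length G = n" "Suc (i + length W) = m"
  shows "comp m n i f g c (X @ G @ W) =
    cop c (\<lambda>c1 c2. ent c2 X (\<lambda>bs d. f c1 (bs @ g d G # W)))"
  using assms by (auto simp: cochain_comp_def)

lemma comp_eq_0: "m \<le> i \<Longrightarrow> comp m n i f g = 0"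
  by (auto simp: cochain_comp_def fun_eq_iff)

lemma comp_zero_left: "comp m n i 0 g = 0"
  by (auto simp: cochain_comp_def fun_eq_iff ent_zero tensor_sum_zero)

lemma multilinear_comp:
  assumes f: "f \<in> cochains sA sC m" and g: "g \<in> cochains sA sC (length G)"
    and "Suc (i + length W) = m"
  shows "multilinear_map sA sC sA i (\<lambda>bs d. f c (bs @ g d G # W))"
proof (rule multilinear_mapI)
  fix bs :: "'a list" assume "length bs = i"
  then show "Vector_Spaces.linear sC sA (\<lambda>d. f c (bs @ g d G # W))"
    using assms by (intro linear_compose_fun[OF cochainsD(3)[OF f] cochainsD(2)[OF g]]) auto
next
  fix d and bs bs' :: "'a list" assume "Suc (length bs + length bs') = i"
  then show "Vector_Spaces.linear sA sA (\<lambda>a. f c ((bs @ a # bs') @ g d G # W))"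
    using assms(3) cochainsD(3)[OF f, of bs "bs' @ g d G # W"] by simp
qed

lemma comp_in_cochains:
  assumes f: "f \<in> cochains sA sC m" and g: "g \<in> cochains sA sC n"
  shows "comp m n i f g \<in> cochains sA sC (m + n - 1)"
proof (cases "i < m")
  case False
  then have "comp m n i f g = 0"
    by (simp add: comp_eq_0)
  then show ?thesis
    using vector_space_A coalg.vector_space_C
    by (auto intro!: cochainsI simp: Vector_Spaces.linear_iff alg.scale_zero_right)
next
  case True
  then obtain k where m: "m = Suc (i + k)"
    using less_imp_Suc_add by blast
  show ?thesis
  proof (rule cochainsI)
    fix c and as :: "'a list" assume "length as \<noteq> m + n - 1"
    then show "comp m n i f g c as = 0"
      by (simp add: cochain_comp_def)
  next
    fix as :: "'a list" assume "length as = m + n - 1"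
    then have "length as = i + (n + k)" by (simp add: m)
    then obtain X G W where as: "as = X @ G @ W" "length X = i" "length G = n" "length W = k"
      by (elim length_eq_addE) auto
    \<comment> \<open>Bilinearity in the two halves makes the Sweedler sum linear in
      \<open>c\<close>.\<close>
    have "bilinear_map sC sC sA (\<lambda>c1 c2. ent c2 X (\<lambda>bs d. f c1 (bs @ g d G # W)))"
      unfolding bilinear_map_def
    proof (intro allI conjI)
      show "Vector_Spaces.linear sC sA (\<lambda>c1. ent c2 X (\<lambda>bs d. f c1 (bs @ g d G # W)))" for c2
        using as m by (intro linear_ent_param cochainsD(2)[OF f]) simp
      show "Vector_Spaces.linear sC sA (\<lambda>c2. ent c2 X (\<lambda>bs d. f c1 (bs @ g d G # W)))" for c1
        using as m g
        by (intro multilinear_mapD(1)[OF multilinear_ent[OF multilinear_comp[OF f]]]) auto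
    qed
    then show "Vector_Spaces.linear sC sA (\<lambda>c. comp m n i f g c as)"
      using as m by (simp add: comp_split coalg.linear_coproduct_sum)
  next
    fix c and as as' :: "'a list" assume len: "Suc (length as + length as') = m + n - 1"
    \<comment> \<open>The varied argument is entwined, is passed to \<open>g\<close>, or lies behind
      the block of \<open>g\<close>.\<close>
    consider "length as < i" | "i \<le> length as" "length as < i + n" | "i + n \<le> length as"
      by linarith
    then show "Vector_Spaces.linear sA sA (\<lambda>a. comp m n i f g c (as @ a # as'))"
    proof cases
      case 1
      then obtain l where l: "i = Suc (length as + l)"
        using less_imp_Suc_add by blast
      then have "length as' = l + (n + k)" using len m by simp
      then obtain X G W where as': "as' = X @ G @ W" "length X = l" "length G = n" "length W = k"
        by (elim length_eq_addE) auto
      have eq: "comp m n i f g c (as @ a # as') =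
          cop c (\<lambda>c1 c2. ent c2 (as @ a # X) (\<lambda>bs d. f c1 (bs @ g d G # W)))" for a
        using comp_split[of "as @ a # X" i G n W m] as' l m by simp
      show ?thesis
        unfolding eq using as' l m g
        by (intro linear_tensor_sum_param
            multilinear_mapD(2)[OF multilinear_ent[OF multilinear_comp[OF f]]]) auto
    next
      case 2
      then obtain l where l: "length as = i + l"
        using le_Suc_ex by blast
      obtain q where q: "n = Suc (l + q)"
        using 2 l less_imp_Suc_add by (metis add_less_cancel_left)
      from l obtain X Y where as: "as = X @ Y" "length X = i" "length Y = l"
        by (elim length_eq_addE)
      have "length as' = q + k" using len m l q by simp
      then obtain Z W where as': "as' = Z @ W" "length Z = q" "length W = k"
        by (elim length_eq_addE)
      have eq: "comp m n i f g c (as @ a # as') =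
          cop c (\<lambda>c1 c2. ent c2 X (\<lambda>bs d. f c1 (bs @ g d (Y @ a # Z) # W)))" for a
        using comp_split[of X i "Y @ a # Z" n W m] as as' q m by simp
      show ?thesis
        unfolding eq using as as' m q
        by (intro linear_tensor_sum_param linear_ent_param
            linear_compose_fun[OF cochainsD(3)[OF f] cochainsD(3)[OF g]]) auto
    next
      case 3
      then obtain l where l: "length as = i + (n + l)"
        using le_Suc_ex by (metis add.assoc)
      then obtain X G Y where as: "as = X @ G @ Y" "length X = i" "length G = n" "length Y = l"
        by (elim length_eq_addE) auto
      have eq: "comp m n i f g c (as @ a # as') =
          cop c (\<lambda>c1 c2. ent c2 X (\<lambda>bs d. f c1 ((bs @ g d G # Y) @ a # as')))" for a
        using comp_split[of X i G n "Y @ a # as'" m] as len m by simp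
      show ?thesis
        unfolding eq using as m len
        by (intro linear_tensor_sum_param linear_ent_param cochainsD(3)[OF f]) auto
    qed
  qed
qed

lemma comp_linear_left:
  shows "comp m n i (f + f') g = comp m n i f g + comp m n i f' g"
    and "comp m n i (cochain_scale sA r f) g = cochain_scale sA r (comp m n i f g)"
proof -
  show "comp m n i (f + f') g = comp m n i f g + comp m n i f' g"
    by (auto simp: cochain_comp_def fun_eq_iff ent_add tensor_sum_add)
  have scale: "Vector_Spaces.linear sA sA (sA r)"
    by (rule alg.linear_scale_self)
  show "comp m n i (cochain_scale sA r f) g = cochain_scale sA r (comp m n i f g)"
    by (auto simp: cochain_comp_def cochain_scale_def fun_eq_iff
        linear_ent[OF scale] linear_tensor_sum[OF scale])
qed

text \<open>The value of \<open>g\<close> enters a single slot of \<open>f\<close>, and linearity of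
  \<open>f\<close> in that slot carries sums and scalars outwards.\<close>

lemma comp_linear_right:
  assumes f: "f \<in> cochains sA sC m"
  shows "comp m n i f (g + g') = comp m n i f g + comp m n i f g'"
    and "comp m n i f (cochain_scale sA r g) = cochain_scale sA r (comp m n i f g)"
proof -
  have lin: "f c (bs @ (a + a') # W) = f c (bs @ a # W) + f c (bs @ a' # W)"
      "f c (bs @ sA r a # W) = sA r (f c (bs @ a # W))"
    if "Suc (length bs + length W) = m" for c bs a a' W
    using cochainsD(3)[OF f that, of c] by (simp_all add: Vector_Spaces.linear_iff)
  show "comp m n i f (g + g') = comp m n i f g + comp m n i f g'"
    by (auto simp: cochain_comp_def fun_eq_iff lin cong: ent_cong
        simp flip: ent_add tensor_sum_add)
  have scale: "Vector_Spaces.linear sA sA (sA r)"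
    by (rule alg.linear_scale_self)
  show "comp m n i f (cochain_scale sA r g) = cochain_scale sA r (comp m n i f g)"
    by (auto simp: cochain_comp_def cochain_scale_def fun_eq_iff lin
        linear_ent[OF scale] linear_tensor_sum[OF scale] cong: ent_cong)
qed

lemma comp_assoc:
  assumes f: "f \<in> cochains sA sC m" and g: "g \<in> cochains sA sC n" and h: "h \<in> cochains sA sC p"
    and ij: "i \<le> j" "j < n + i"
  shows "comp (m + n - 1) p j (comp m n i f g) h = comp m (n + p - 1) i f (comp n p (j - i) g h)"
proof (cases "i < m")
  case False
  \<comment> \<open>On the left the inner composite is zero, on the right the outer one is.\<close>
  then show ?thesis by (simp add: comp_eq_0 comp_zero_left)
next
  case True
  then obtain k where m: "m = Suc (i + k)"
    using less_imp_Suc_add by blast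
  obtain l where j: "j = i + l"
    using ij le_Suc_ex by blast
  obtain q where n: "n = Suc (l + q)"
    using ij j less_imp_Suc_add by (metis add.commute add_less_cancel_left)
  show ?thesis
  proof (intro ext)
    fix c :: 'c and as :: "'a list"
    show "comp (m + n - 1) p j (comp m n i f g) h c as =
      comp m (n + p - 1) i f (comp n p (j - i) g h) c as"
    proof (cases "length as = i + (l + (p + (q + k)))")
      case False
      then show ?thesis by (simp add: cochain_comp_def m n)
    next
      case True
      \<comment> \<open>\<open>X\<close> precedes the block of \<open>g\<close>, the lists
        \<open>Y\<close> and \<open>Z\<close> are the arguments of \<open>g\<close> around the block
        \<open>H\<close> of \<open>h\<close>, and \<open>W\<close> follows the block of
        \<open>g\<close>.\<close>
      then obtain X Y H Z W where as: "as = X @ Y @ H @ Z @ W" "length X = i" "length Y = l"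
        "length H = p" "length Z = q" "length W = k"
        by (elim length_eq_addE) auto
      define G where "G c1 bs d e =
        ent e Y (\<lambda>ys e'. f c1 (bs @ g d (ys @ h e' H # Z) # W))" for c1 bs d e
      \<comment> \<open>The common form of both sides: \<open>f\<close> receives \<open>c1\<close>,
        while \<open>g\<close> and \<open>h\<close> receive what entwining makes of
        \<open>c2\<close> and \<open>c3\<close>. The list \<open>X\<close> passes \<open>c3\<close>
        and then \<open>c2\<close>, whereas \<open>Y\<close> passes only what \<open>X\<close> has
        made of \<open>c3\<close>.\<close>
      define T where "T c1 c2 c3 =
        ent c3 X (\<lambda>xs e. ent c2 xs (\<lambda>bs d. G c1 bs d e))" for c1 c2 c3
      have G1: "multilinear_map sA sC sA (length X) (\<lambda>bs e. G c1 bs d e)" for c1 d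
      proof (rule multilinear_mapI)
        fix bs :: "'a list" assume bs: "length bs = length X"
        have "multilinear_map sA sC sA l (\<lambda>ys e'. f c1 (bs @ g d (ys @ h e' H # Z) # W))"
          using bs as m n h
          by (intro multilinear_map_compose[OF cochainsD(3)[OF f] multilinear_comp[OF g]]) auto
        then show "Vector_Spaces.linear sC sA (\<lambda>e. G c1 bs d e)"
          unfolding G_def using as by (intro multilinear_mapD(1)[OF multilinear_ent])
      next
        fix e and bs bs' :: "'a list" assume "Suc (length bs + length bs') = length X"
        then show "Vector_Spaces.linear sA sA (\<lambda>a. G c1 (bs @ a # bs') d e)"
          unfolding G_def using as m cochainsD(3)[OF f, of bs "bs' @ _ # W"]
          by (intro linear_ent_param) simp
      qed
      have G2: "multilinear_map sA sC sA (length X) (\<lambda>bs d. G c1 bs d e)" for c1 e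
      proof (rule multilinear_mapI)
        fix bs :: "'a list" assume bs: "length bs = length X"
        then show "Vector_Spaces.linear sC sA (\<lambda>d. G c1 bs d e)"
          unfolding G_def using as m n
          by (intro linear_ent_param linear_compose_fun[OF cochainsD(3)[OF f] cochainsD(2)[OF g]])
            auto
      next
        fix d and bs bs' :: "'a list" assume "Suc (length bs + length bs') = length X"
        then show "Vector_Spaces.linear sA sA (\<lambda>a. G c1 (bs @ a # bs') d e)"
          by (rule multilinear_mapD(2)[OF G1])
      qed
      have G3: "Vector_Spaces.linear sC sA (\<lambda>c1. G c1 bs d e)" if "length bs = length X" for bs d e
        unfolding G_def using as m that by (intro linear_ent_param cochainsD(2)[OF f]) simp
      have T: "trilinear_map sC sC sC sA T"
        unfolding trilinear_map_def T_def
        using multilinear_mapD(1)[OF multilinear_ent[OF multilinear_ent_ent[OF G1 G2]]]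
          multilinear_mapD(1)[OF multilinear_ent[OF G2]] G3
        by (auto intro!: linear_ent_param)
      have "comp (m + n - 1) p j (comp m n i f g) h c as =
        cop c (\<lambda>c1 c2. cop c1 (\<lambda>c11 c12. T c11 c12 c2))"
      proof -
        have inner: "comp m n i f g c1 ((xs @ ys) @ h e H # Z @ W) =
          cop c1 (\<lambda>c11 c12. ent c12 xs (\<lambda>bs d. f c11 (bs @ g d (ys @ h e H # Z) # W)))"
          if "length xs = length X" "length ys = length Y" for c1 e xs ys
          using comp_split[of xs i "ys @ h e H # Z" n W m f g c1] that as m n by simp
        have "comp (m + n - 1) p j (comp m n i f g) h c as =
          cop c (\<lambda>c1 c2. ent c2 (X @ Y) (\<lambda>bs e. comp m n i f g c1 (bs @ h e H # Z @ W)))"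
          using comp_split[of "X @ Y" j H p "Z @ W" "m + n - 1"] as m n j by simp
        also have "\<dots> = cop c (\<lambda>c1 c2. ent c2 X (\<lambda>xs d. ent d Y (\<lambda>ys e.
            cop c1 (\<lambda>c11 c12. ent c12 xs (\<lambda>bs d. f c11 (bs @ g d (ys @ h e H # Z) # W))))))"
          unfolding ent_append by (intro tensor_sum_cong ent_cong inner)
        also have "\<dots> = cop c (\<lambda>c1 c2. cop c1 (\<lambda>c11 c12. T c11 c12 c2))"
          \<comment> \<open>The coproduct of \<open>c1\<close> is moved outwards. Then the entwining
            of \<open>Y\<close> is exchanged with that of \<open>xs\<close> past \<open>c12\<close>,
            which is independent of it.\<close>
          unfolding T_def G_def ent_tensor_sum_swap by (intro tensor_sum_cong ent_cong ent_swap)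
        finally show ?thesis .
      qed
      also have "\<dots> = cop c (\<lambda>c1 c2. cop c2 (\<lambda>c21 c22. T c1 c21 c22))"
        by (rule coalg.coassoc_sum[OF T])
      also have "\<dots> = comp m (n + p - 1) i f (comp n p (j - i) g h) c as"
      proof -
        have inner: "f c1 (bs @ comp n p l g h d (Y @ H @ Z) # W) = cop d (\<lambda>d1 d2. G c1 bs d1 d2)"
          if "length bs = length X" for c1 bs d
        proof -
          have L: "Vector_Spaces.linear sA sA (\<lambda>a. f c1 (bs @ a # W))"
            using that as m by (intro cochainsD(3)[OF f]) simp
          show ?thesis
            unfolding G_def using comp_split[of Y l H p Z n g h d] as n
            by (simp add: linear_tensor_sum[OF L] linear_ent[OF L])
        qed
        have "comp m (n + p - 1) i f (comp n p (j - i) g h) c as =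
            cop c (\<lambda>c1 c2. ent c2 X (\<lambda>bs d. f c1 (bs @ comp n p l g h d (Y @ H @ Z) # W)))"
          using comp_split[of X i "Y @ H @ Z" "n + p - 1" W m] as m n j by simp
        also have "\<dots> = cop c (\<lambda>c1 c2. ent c2 X (\<lambda>bs d. cop d (\<lambda>d1 d2. G c1 bs d1 d2)))"
          by (intro tensor_sum_cong ent_cong inner)
        also have "\<dots> = cop c (\<lambda>c1 c2. cop c2 (\<lambda>c21 c22. T c1 c21 c22))"
          \<comment> \<open>Here \<open>X\<close> is entwined before the coproduct is taken;
            splitting first makes it pass both halves in turn.\<close>
          unfolding T_def by (intro tensor_sum_cong ent_coproduct[OF G1 G2])
        finally show ?thesis by simp
      qed
      finally show ?thesis .
    qed
  qed
qed

section \<open>Insertion of the multiplication cochain\<close>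

lemma pi_in_cochains: "cochain_pi sA \<epsilon> \<in> cochains sA sC 2"
proof (rule cochainsI)
  fix as :: "'a list"
  show "Vector_Spaces.linear sC sA (\<lambda>c. cochain_pi sA \<epsilon> c as)" if "length as = 2"
    using that vector_space_A coalg.vector_space_C coalg.counit_linear
    by (simp add: cochain_pi_def Vector_Spaces.linear_iff alg.scale_left_distrib)
next
  fix c and as as' :: "'a list" assume "Suc (length as + length as') = 2"
  then consider a where "as = [a]" "as' = []" | a where "as = []" "as' = [a]"
    by (cases as; cases as') auto
  then show "Vector_Spaces.linear sA sA (\<lambda>a. cochain_pi sA \<epsilon> c (as @ a # as'))"
    using vector_space_A
    by cases (simp_all add: cochain_pi_def Vector_Spaces.linear_iff distrib_left distrib_right
        alg.scale_right_distrib alg.scale_mult_left alg.scale_mult_right alg.scale_left_commute)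
qed (simp add: cochain_pi_def)

text \<open>The scalar \<open>\<epsilon> d\<close> leaves the slot of \<open>f\<close> by linearity,
  \<open>ent_counit\<close> removes the entwining of \<open>X\<close>, and the right counit law
  collapses the coproduct.\<close>

lemma comp_pi:
  assumes f: "f \<in> cochains sA sC m" and len: "length X = i" "Suc (i + length W) = m"
  shows "comp m 2 i f (cochain_pi sA \<epsilon>) c (X @ a # b # W) = f c (X @ a * b # W)"
proof -
  have "comp m 2 i f (cochain_pi sA \<epsilon>) c (X @ a # b # W) =
      cop c (\<lambda>c1 c2. ent c2 X (\<lambda>bs d. f c1 (bs @ sA (\<epsilon> d) (a * b) # W)))"
    using comp_split[of X i "[a, b]" 2 W m f "cochain_pi sA \<epsilon>" c] len
    by (simp add: cochain_pi_def)
  also have "\<dots> = cop c (\<lambda>c1 c2. ent c2 X (\<lambda>bs d. sA (\<epsilon> d) (f c1 (bs @ a * b # W))))"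
    using cochainsD(3)[OF f] len
    by (intro tensor_sum_cong ent_cong) (simp add: Vector_Spaces.linear_iff)
  also have "\<dots> = cop c (\<lambda>c1 c2. sA (\<epsilon> c2) (f c1 (X @ a * b # W)))"
    using cochainsD(3)[OF f, of _ "_ @ a * b # W"] len
    by (intro tensor_sum_cong ent_counit vector_space_A) simp
  also have "\<dots> = f c (X @ a * b # W)"
    using len by (intro coalg.counit_right_sum cochainsD(2)[OF f]) simp
  finally show ?thesis .
qed

text \<open>The arguments \<open>a\<close> and \<open>b\<close> lie before the slot of
  \<open>g\<close>, so they are entwined: as a product on the left, as a pair on the right. After
  \<open>comp_pi\<close> the difference is exactly \<open>ent_mult\<close>.\<close>

lemma comp_interchange_pi_right:
  assumes f: "f \<in> cochains sA sC m" and g: "g \<in> cochains sA sC n" and "j < i"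
  shows "comp (m + n - 1) 2 j (comp m n i f g) (cochain_pi sA \<epsilon>) =
    comp (m + 2 - 1) n (i + 2 - 1) (comp m 2 j f (cochain_pi sA \<epsilon>)) g"
proof (cases "i < m")
  case False
  then show ?thesis by (simp add: comp_eq_0 comp_zero_left)
next
  case True
  then obtain k where m: "m = Suc (i + k)"
    using less_imp_Suc_add by blast
  obtain l where i: "i = Suc (j + l)"
    using \<open>j < i\<close> less_imp_Suc_add by blast
  show ?thesis
  proof (intro ext)
    fix c :: 'c and as :: "'a list"
    show "comp (m + n - 1) 2 j (comp m n i f g) (cochain_pi sA \<epsilon>) c as =
      comp (m + 2 - 1) n (i + 2 - 1) (comp m 2 j f (cochain_pi sA \<epsilon>)) g c as"
    proof (cases "length as = j + (2 + (l + (n + k)))")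
      case False
      then show ?thesis by (simp add: cochain_comp_def m i)
    next
      case True
      then obtain X P Y G W where as: "as = X @ P @ Y @ G @ W" "length X = j" "length P = 2"
        "length Y = l" "length G = n" "length W = k"
        by (elim length_eq_addE) auto
      obtain a b where P: "P = [a, b]"
        using as(3) by (auto simp: numeral_2_eq_2 length_Suc_conv)
      define F where "F c1 bs d = f c1 (bs @ g d G # W)" for c1 bs d
      have F: "multilinear_map sA sC sA (Suc l) (\<lambda>bs d. F c1 (X' @ bs) d)"
        if "length X' = j" for c1 X'
        unfolding F_def using that as m i g
        by (intro multilinear_map_append multilinear_comp[OF f]) auto
      have "comp (m + n - 1) 2 j (comp m n i f g) (cochain_pi sA \<epsilon>) c as =
          comp m n i f g c (X @ a * b # Y @ G @ W)"
        using comp_pi[OF comp_in_cochains[OF f g], of X j "Y @ G @ W" i c a b] as P m i by simp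
      also have "\<dots> = cop c (\<lambda>c1 c2. ent c2 (X @ a * b # Y) (F c1))"
        unfolding F_def using comp_split[of "X @ a * b # Y" i G n W m] as m i by simp
      also have "\<dots> = cop c (\<lambda>c1 c2. ent c2 (X @ P @ Y) (\<lambda>bs d.
          comp m 2 j f (cochain_pi sA \<epsilon>) c1 (bs @ g d G # W)))"
      proof (rule tensor_sum_cong)
        fix c1 c2
        \<comment> \<open>\<open>drop 2 bs\<close> is the entwined \<open>Y\<close>; the first two
          entries of \<open>bs\<close> are the entwined factors.\<close>
        have "ent c2 (X @ a * b # Y) (F c1) = ent c2 X (\<lambda>xs d. ent d (P @ Y)
            (\<lambda>bs e. F c1 (xs @ bs ! 0 * bs ! 1 # drop 2 bs) e))"
          unfolding ent_append[of c2 X]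
        proof (intro ent_cong)
          fix d and xs :: "'a list" assume "length xs = length X"
          then show "ent d (a * b # Y) (\<lambda>bs. F c1 (xs @ bs)) =
              ent d (P @ Y) (\<lambda>bs e. F c1 (xs @ bs ! 0 * bs ! 1 # drop 2 bs) e)"
            using ent_mult[of sA Y "\<lambda>bs. F c1 (xs @ bs)" d a b] F as
            by (simp add: P numeral_2_eq_2)
        qed
        also have "\<dots> = ent c2 X (\<lambda>xs d. ent d (P @ Y)
            (\<lambda>bs e. comp m 2 j f (cochain_pi sA \<epsilon>) c1 ((xs @ bs) @ g e G # W)))"
        proof (intro ent_cong)
          fix d e and xs bs :: "'a list" assume len: "length xs = length X" "length bs = length (P @ Y)"
          then obtain a' b' ys where "bs = a' # b' # ys" "length ys = length Y"
            by (auto simp: P length_Suc_conv)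
          then show "F c1 (xs @ bs ! 0 * bs ! 1 # drop 2 bs) e =
              comp m 2 j f (cochain_pi sA \<epsilon>) c1 ((xs @ bs) @ g e G # W)"
            unfolding F_def
            using comp_pi[OF f, of xs j "ys @ g e G # W" c1 a' b'] as len m i by simp
        qed
        finally show "ent c2 (X @ a * b # Y) (F c1) = ent c2 (X @ P @ Y) (\<lambda>bs d.
          comp m 2 j f (cochain_pi sA \<epsilon>) c1 (bs @ g d G # W))"
          by (simp only: ent_append)
      qed
      also have "\<dots> = comp (m + 2 - 1) n (i + 2 - 1) (comp m 2 j f (cochain_pi sA \<epsilon>)) g c as"
        using comp_split[of "X @ P @ Y" "i + 2 - 1" G n W "m + 2 - 1"] as m i by simp
      finally show ?thesis .
    qed
  qed
qed

text \<open>The arguments to be multiplied lie behind the block of \<open>h\<close> and are never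
  entwined, so \<open>comp_pi\<close> suffices. The position is shifted by \<open>p - 1\<close>
  because \<open>h\<close> takes \<open>p\<close> arguments in place of one.\<close>

lemma comp_interchange_pi_left:
  assumes f: "f \<in> cochains sA sC m" and h: "h \<in> cochains sA sC p" and "j < i"
  shows "comp (m + 2 - 1) p j (comp m 2 i f (cochain_pi sA \<epsilon>)) h =
    comp (m + p - 1) 2 (i + p - 1) (comp m p j f h) (cochain_pi sA \<epsilon>)"
proof (cases "i < m")
  case False
  then show ?thesis by (simp add: comp_eq_0 comp_zero_left)
next
  case True
  then obtain k where m: "m = Suc (i + k)"
    using less_imp_Suc_add by blast
  obtain l where i: "i = Suc (j + l)"
    using \<open>j < i\<close> less_imp_Suc_add by blast
  show ?thesis
  proof (intro ext)
    fix c :: 'c and as :: "'a list"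
    show "comp (m + 2 - 1) p j (comp m 2 i f (cochain_pi sA \<epsilon>)) h c as =
      comp (m + p - 1) 2 (i + p - 1) (comp m p j f h) (cochain_pi sA \<epsilon>) c as"
    proof (cases "length as = j + (p + (l + (2 + k)))")
      case False
      then show ?thesis by (simp add: cochain_comp_def m i)
    next
      case True
      then obtain X H Y P W where as: "as = X @ H @ Y @ P @ W" "length X = j" "length H = p"
        "length Y = l" "length P = 2" "length W = k"
        by (elim length_eq_addE) auto
      obtain a b where P: "P = [a, b]"
        using as(5) by (auto simp: numeral_2_eq_2 length_Suc_conv)
      have inner: "comp m 2 i f (cochain_pi sA \<epsilon>) c1 (bs @ h d H # Y @ P @ W) =
          f c1 (bs @ h d H # Y @ a * b # W)" if "length bs = length X" for c1 bs d
        using comp_pi[OF f, of "bs @ h d H # Y" i W c1 a b] that as m i P by simp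
      have "comp (m + 2 - 1) p j (comp m 2 i f (cochain_pi sA \<epsilon>)) h c as =
          cop c (\<lambda>c1 c2. ent c2 X (\<lambda>bs d.
            comp m 2 i f (cochain_pi sA \<epsilon>) c1 (bs @ h d H # Y @ P @ W)))"
        using comp_split[of X j H p "Y @ P @ W" "m + 2 - 1"] as m i by simp
      also have "\<dots> = cop c (\<lambda>c1 c2. ent c2 X (\<lambda>bs d. f c1 (bs @ h d H # Y @ a * b # W)))"
        by (intro tensor_sum_cong ent_cong inner)
      also have "\<dots> = comp m p j f h c (X @ H @ Y @ a * b # W)"
        using comp_split[of X j H p "Y @ a * b # W" m] as m i by simp
      also have "\<dots> = comp (m + p - 1) 2 (i + p - 1) (comp m p j f h) (cochain_pi sA \<epsilon>) c as"
        using comp_pi[OF comp_in_cochains[OF f h], of "X @ H @ Y" "i + p - 1" W j c a b] as m i P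
        by simp
      finally show ?thesis .
    qed
  qed
qed

text \<open>By \<open>comp_pi\<close> the two sides are \<open>\<epsilon> c\<close> times the two
  bracketings of a triple product.\<close>

lemma comp_pi_pi:
  "comp 2 2 0 (cochain_pi sA \<epsilon>) (cochain_pi sA \<epsilon>) = comp 2 2 1 (cochain_pi sA \<epsilon>) (cochain_pi sA \<epsilon>)"
proof (intro ext)
  fix c :: 'c and as :: "'a list"
  show "comp 2 2 0 (cochain_pi sA \<epsilon>) (cochain_pi sA \<epsilon>) c as =
    comp 2 2 1 (cochain_pi sA \<epsilon>) (cochain_pi sA \<epsilon>) c as"
  proof (cases "length as = 3")
    case False
    then show ?thesis by (simp add: cochain_comp_def)
  next
    case True
    then obtain a b d where "as = [a, b, d]"
      by (auto simp: numeral_3_eq_3 length_Suc_conv)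
    then show ?thesis
      using comp_pi[OF pi_in_cochains, of "[]" 0 "[d]" c a b]
        comp_pi[OF pi_in_cochains, of "[a]" 1 "[]" c b d]
      by (simp add: cochain_pi_def mult.assoc)
  qed
qed

section \<open>The ambient vector space of the cochains\<close>

lemma vector_space_cochain_scale: "vector_space (cochain_scale sA)"
  by unfold_locales
    (simp_all add: cochain_scale_def fun_eq_iff alg.scale_right_distrib alg.scale_left_distrib)

lemma subspace_cochains: "module.subspace (cochain_scale sA) (cochains sA sC n)"
proof -
  interpret W: vector_space "cochain_scale sA"
    by (rule vector_space_cochain_scale)
  show ?thesis
    using vector_space_A coalg.vector_space_C
    by (auto simp: W.subspace_def cochains_def cochain_scale_def Vector_Spaces.linear_iff
        alg.scale_right_distrib alg.scale_left_commute algebra_simps)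
qed

end

theorem proposition4p10:
  fixes sA :: "'k::field \<Rightarrow> 'a::{ring,monoid_mult} \<Rightarrow> 'a"
    and sC :: "'k \<Rightarrow> 'c::ab_group_add \<Rightarrow> 'c"
    and \<Delta> :: "'c \<Rightarrow> ('k, 'c, 'c) tensor"
    and \<epsilon> :: "'c \<Rightarrow> 'k"
    and \<psi> :: "'c \<Rightarrow> 'a \<Rightarrow> ('k, 'a, 'c) tensor"
  assumes "entwining_structure sA sC \<Delta> \<epsilon> \<psi>"
  shows "weak_comp_algebra (cochain_scale sA) (cochains sA sC)
           (cochain_comp sA sC \<Delta> \<psi>) (cochain_pi sA \<epsilon>)"
proof -
  interpret entwining_structure sA sC \<Delta> \<epsilon> \<psi> by (rule assms)
  show ?thesis
    by (intro weak_comp_algebra.intro weak_comp_algebra_axioms.intro vector_space_cochain_scale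
        subspace_cochains pi_in_cochains comp_in_cochains comp_linear_left comp_linear_right
        comp_eq_0 comp_assoc comp_pi_pi)
      \<comment> \<open>The interchange axiom remains; its two cases, \<open>g\<close> or
        \<open>h\<close> equal to the multiplication cochain, are the two lemmas.\<close>
      (auto simp only: comp_interchange_pi_left comp_interchange_pi_right)
qed

end
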